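(* Let $F$ be a field of characteristic not $2$ and let $R$ be a unital commutative associative $F$-algebra which is a unique factorization domain. Let ${\mathfrak h}=F\begin{pmatrix}1&0\\0&-1\end{pmatrix}\subset\mathfrak{sl}_2(R)$. If ${\mathfrak h}'$ is a MAD of $\mathfrak{sl}_2(R)$, then $\dim_F{\mathfrak h}'=1$ and there is $P\in GL_2(R)$ such that $P^{-1}{\mathfrak h}'P={\mathfrak h}$.
   Context: $\mathfrak{sl}_2(R)$ denotes the set of $2\times 2$ matrices $\begin{pmatrix}a&b\\c&-a\end{pmatrix}$ with $a,b,c\in R$, viewed as a Lie algebra over $F$ under the commutator bracket; subalgebras are $F$-Lie subalgebras. $F$ is identified with its image in $R$. $GL_2(R)$ is the group of $2\times 2$ matrices over $R$ whose determinant is a unit of $R$. An abelian subalgebra ${\mathfrak a}$ of $\mathfrak{sl}_2(R)$ is called ad-diagonalizable if $\mathrm{ad}\,Z$ is diagonalizable over $F$ on $\mathfrak{sl}_2(R)$ for all $Z\in{\mathfrak a}$ (with an $F$-basis of eigenvectors and eigenvalues in $F$); more precisely, this means $$\mathfrak{sl}_2(R)=\bigoplus_{\alpha\in{\mathfrak a}^*}\mathfrak{sl}_2(R)_\alpha,$$ where ${\mathfrak a}^*=\mathrm{Hom}_F({\mathfrak a},F)$ and $\mathfrak{sl}_2(R)_\alpha=\{Z\in\mathfrak{sl}_2(R)\mid [A,Z]=\alpha(A)Z\text{ for all }A\in{\mathfrak a}\}$. A MAD (maximal abelian ad-diagonalizable subalgebra) is an element, maximal with respect to inclusion, of the family of all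 abelian ad-diagonalizable subalgebras of $\mathfrak{sl}_2(R)$. *)

theory Defs
  imports "HOL-Analysis.Analysis" "HOL-Computational_Algebra.Computational_Algebra"
begin

text \<open>
  A unital associative commutative \<open>F\<close>-algebra: the ring \<open>R\<close> is a type of class
  \<^class>\<open>comm_ring_1\<close> and the \<open>F\<close>-structure is an explicit scalar multiplication.
  The image of \<open>c \<in> F\<close> in \<open>R\<close> is \<open>smul c 1\<close>.
\<close>

locale comm_algebra = vector_space smul
  for smul :: "'f::field \<Rightarrow> 'r::comm_ring_1 \<Rightarrow> 'r" +
  assumes scale_mult_left: "smul c (x * y) = smul c x * y"

definition mat_scale :: "('f \<Rightarrow> 'r \<Rightarrow> 'r) \<Rightarrow> 'f \<Rightarrow> 'r^2^2 \<Rightarrow> 'r^2^2" where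
  "mat_scale smul c A = (\<chi> i j. smul c (A $ i $ j))"

lemma (in comm_algebra) vector_space_mat_scale: "vector_space (mat_scale smul)"
  by unfold_locales
    (simp_all add: mat_scale_def vec_eq_iff scale_right_distrib scale_left_distrib)

definition sl2 :: "('r::comm_ring_1^2^2) set" where
  "sl2 = {vector [vector [a, b], vector [c, - a]] | a b c. True}"

definition GL2 :: "('r::comm_ring_1^2^2) set" where
  "GL2 = {P. det P dvd 1}"

definition bracket :: "'r::comm_ring_1^2^2 \<Rightarrow> 'r^2^2 \<Rightarrow> 'r^2^2" where
  "bracket A B = A ** B - B ** A"

definition lie_subalgebra_sl2 ::
    "('f::field \<Rightarrow> 'r::comm_ring_1 \<Rightarrow> 'r) \<Rightarrow> ('r^2^2) set \<Rightarrow> bool" where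
  "lie_subalgebra_sl2 smul \<aa> \<longleftrightarrow>
     \<aa> \<subseteq> sl2 \<and> module.subspace (mat_scale smul) \<aa> \<and>
     (\<forall>A\<in>\<aa>. \<forall>B\<in>\<aa>. bracket A B \<in> \<aa>)"

definition abelian_subalgebra_sl2 ::
    "('f::field \<Rightarrow> 'r::comm_ring_1 \<Rightarrow> 'r) \<Rightarrow> ('r^2^2) set \<Rightarrow> bool" where
  "abelian_subalgebra_sl2 smul \<aa> \<longleftrightarrow>
     lie_subalgebra_sl2 smul \<aa> \<and> (\<forall>A\<in>\<aa>. \<forall>B\<in>\<aa>. bracket A B = 0)"

text \<open>
  Functionals on \<open>\<aa>\<close> are taken in \<^term>\<open>extensional \<aa>\<close>, so that each element of the
  dual space is represented by exactly one function; otherwise the family of weight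
  spaces would contain repetitions and its sum could never be direct.
\<close>

definition dual_space ::
    "('f::field \<Rightarrow> 'r::comm_ring_1 \<Rightarrow> 'r) \<Rightarrow> ('r^2^2) set \<Rightarrow> ('r^2^2 \<Rightarrow> 'f) set" where
  "dual_space smul \<aa> = {\<alpha> \<in> extensional \<aa>.
     (\<forall>A\<in>\<aa>. \<forall>B\<in>\<aa>. \<alpha> (A + B) = \<alpha> A + \<alpha> B) \<and>
     (\<forall>c. \<forall>A\<in>\<aa>. \<alpha> (mat_scale smul c A) = c * \<alpha> A)}"

definition weight_space ::
    "('f::field \<Rightarrow> 'r::comm_ring_1 \<Rightarrow> 'r) \<Rightarrow> ('r^2^2) set \<Rightarrow> ('r^2^2 \<Rightarrow> 'f) \<Rightarrow> ('r^2^2) set" where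
  "weight_space smul \<aa> \<alpha> = {Z \<in> sl2. \<forall>A\<in>\<aa>. bracket A Z = mat_scale smul (\<alpha> A) Z}"

text \<open>
  Internal direct sum of a possibly infinite family of subspaces: every vector is in a
  unique way a sum of finitely many components.
\<close>

definition internal_direct_sum ::
    "('f::field \<Rightarrow> 'v::ab_group_add \<Rightarrow> 'v) \<Rightarrow> 'v set \<Rightarrow> 'i set \<Rightarrow> ('i \<Rightarrow> 'v set) \<Rightarrow> bool" where
  "internal_direct_sum s V I W \<longleftrightarrow>
     module.subspace s V \<and> (\<forall>i\<in>I. module.subspace s (W i) \<and> W i \<subseteq> V) \<and>
     (\<forall>v\<in>V. \<exists>!f. (\<forall>i\<in>I. f i \<in> W i) \<and> (\<forall>i. i \<notin> I \<longrightarrow> f i = 0) \<and>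
        finite {i. f i \<noteq> 0} \<and> v = (\<Sum>i | f i \<noteq> 0. f i))"

definition ad_diagonalizable ::
    "('f::field \<Rightarrow> 'r::comm_ring_1 \<Rightarrow> 'r) \<Rightarrow> ('r^2^2) set \<Rightarrow> bool" where
  "ad_diagonalizable smul \<aa> \<longleftrightarrow>
     internal_direct_sum (mat_scale smul) sl2 (dual_space smul \<aa>) (weight_space smul \<aa>)"

definition is_MAD ::
    "('f::field \<Rightarrow> 'r::comm_ring_1 \<Rightarrow> 'r) \<Rightarrow> ('r^2^2) set \<Rightarrow> bool" where
  "is_MAD smul \<hh> \<longleftrightarrow>
     abelian_subalgebra_sl2 smul \<hh> \<and> ad_diagonalizable smul \<hh> \<and>
     (\<forall>\<kk>. abelian_subalgebra_sl2 smul \<kk> \<and> ad_diagonalizable smul \<kk> \<and> \<hh> \<subseteq> \<kk> \<longrightarrow> \<kk> = \<hh>)"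

definition standard_cartan :: "('f::field \<Rightarrow> 'r::comm_ring_1 \<Rightarrow> 'r) \<Rightarrow> ('r^2^2) set" where
  "standard_cartan smul = {mat_scale smul c (vector [vector [1, 0], vector [0, - 1]]) | c. True}"

end

theory Submission
  imports Defs
begin

text \<open>
  Write \<open>Z = (a, b; c, -a)\<close> and \<open>d = a\<^sup>2 + b c\<close>, so that \<open>Z\<^sup>2 = d\<close>.  Then
  \<open>(ad Z)\<^sup>3 = 4 d ad Z\<close>, hence every nonzero eigenvalue \<open>k\<close> of \<open>ad Z\<close> satisfies
  \<open>k\<^sup>2 = 4 d\<close>.  If \<open>Z \<noteq> 0\<close> lies in an ad-diagonalizable subalgebra, such a \<open>k\<close> exists
  in \<open>F\<close>: otherwise \<open>Z\<close> would kill all weight spaces, and \<open>sl2\<close> has no centre in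
  characteristic different from 2.  Thus \<open>d\<close> is the square of a nonzero scalar
  (\<open>ad_diagonalizable_square\<close>), and \<open>Z\<close> can be rescaled so that \<open>Z\<^sup>2 = 1\<close>.  A matrix of trace
  zero commuting with this \<open>Z\<close> is \<open>t Z\<close> for some \<open>t \<in> R\<close>; if it lies in the same subalgebra,
  then \<open>t\<^sup>2\<close> is again the square of a scalar, which in a domain forces \<open>t \<in> F\<close>.  So a nonzero
  abelian ad-diagonalizable subalgebra is a line \<open>F Z\<close> (\<open>ad_diagonalizable_span\<close>).

  For the conjugation, \<open>(1 + Z)/2\<close> is an idempotent of determinant 0 and trace 1.  Unique
  factorisation writes a singular matrix as a column times a row (\<open>det_zero_column_row\<close>).
  Trace 1 says that this row and column pair to 1, so that they complete to a matrix of
  determinant 1, and this matrix conjugates \<open>Z\<close> to \<open>H = diag(1, -1)\<close>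
  (\<open>involution_conjugate_diagonal\<close>).

  Maximality excludes the zero subalgebra, because \<open>F H\<close> is abelian and ad-diagonalizable,
  with weights \<open>0\<close>, \<open>2\<close> and \<open>-2\<close>.
\<close>


section \<open>Two by two matrices\<close>

definition mat2 :: "'r \<Rightarrow> 'r \<Rightarrow> 'r \<Rightarrow> 'r \<Rightarrow> 'r::comm_ring_1^2^2" where
  "mat2 a b c d = vector [vector [a, b], vector [c, d]]"

lemma mat2_eq_iff [simp]:
  "mat2 a b c d = mat2 a' b' c' d' \<longleftrightarrow> a = a' \<and> b = b' \<and> c = c' \<and> d = d'"
  by (auto simp: mat2_def vec_eq_iff forall_2)

lemma mat2_mult [simp]:
  "mat2 a b c d ** mat2 a' b' c' d' =
     mat2 (a * a' + b * c') (a * b' + b * d') (c * a' + d * c') (c * b' + d * d')"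
  by (simp add: mat2_def vec_eq_iff forall_2 matrix_matrix_mult_def sum_2)

lemma mat2_add [simp]: "mat2 a b c d + mat2 a' b' c' d' = mat2 (a + a') (b + b') (c + c') (d + d')"
  by (simp add: mat2_def vec_eq_iff forall_2)

lemma mat2_diff [simp]: "mat2 a b c d - mat2 a' b' c' d' = mat2 (a - a') (b - b') (c - c') (d - d')"
  by (simp add: mat2_def vec_eq_iff forall_2)

lemma mat2_scale [simp]: "mat_scale s k (mat2 a b c d) = mat2 (s k a) (s k b) (s k c) (s k d)"
  by (simp add: mat2_def mat_scale_def vec_eq_iff forall_2)

lemma zero_eq_mat2: "0 = mat2 0 0 0 0"
  by (simp add: mat2_def vec_eq_iff forall_2)

lemma one_eq_mat2: "mat 1 = mat2 1 0 0 1"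
  by (simp add: mat2_def mat_def vec_eq_iff forall_2)

lemma det_mat2: "det (mat2 a b c d) = a * d - b * c"
  by (simp add: mat2_def det_2)

lemma sl2_eq: "sl2 = {mat2 a b c (- a) | a b c. True}"
  by (simp add: sl2_def mat2_def)

lemma mat2_in_sl2 [simp]: "mat2 a b c (- a) \<in> sl2"
  by (auto simp: sl2_eq)

lemma sl2_cases:
  assumes "Z \<in> sl2"
  obtains a b c where "Z = mat2 a b c (- a)"
  using assms by (auto simp: sl2_eq)

lemma bracket_sl2:
  "bracket (mat2 a b c (- a)) (mat2 x y z (- x)) =
     mat2 (b * z - c * y) (2 * (a * y - b * x)) (2 * (c * x - a * z)) (- (b * z - c * y))"
  by (simp add: bracket_def algebra_simps)

lemma bracket_zero_right: "bracket A 0 = 0"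
  by (simp add: bracket_def)

lemma bracket_add_right: "bracket A (B + C) = bracket A B + bracket A C"
  by (simp add: bracket_def vec_eq_iff matrix_matrix_mult_def sum.distrib algebra_simps)

lemma bracket_sum_right: "bracket A (\<Sum>i\<in>I. B i) = (\<Sum>i\<in>I. bracket A (B i))"
  by (induction I rule: infinite_finite_induct)
    (simp_all add: bracket_zero_right bracket_add_right)

lemma matrix_inv_eqI:
  fixes P Q :: "'a::semiring_1^'n^'n"
  assumes "P ** Q = mat 1" "Q ** P = mat 1"
  shows "matrix_inv P = Q"
proof -
  have "P ** matrix_inv P = mat 1 \<and> matrix_inv P ** P = mat 1"
    unfolding matrix_inv_def by (rule someI[of _ Q]) (use assms in blast)
  then show ?thesis
    by (metis assms(2) matrix_mul_assoc matrix_mul_lid matrix_mul_rid)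
qed


section \<open>Factorisation in a unique factorisation domain\<close>

text \<open>
  In a unique factorisation domain every nonzero element is primal: each prime factor of
  \<open>x\<close> divides one of the two factors \<open>y\<close>, \<open>z\<close>, and can be sorted and cancelled there.
\<close>

lemma dvd_mult_split:
  fixes x :: "'r::{idom, factorial_semiring}"
  assumes "x \<noteq> 0" "x dvd y * z"
  shows "\<exists>u v. x = u * v \<and> u dvd y \<and> v dvd z"
  using assms
proof (induction x arbitrary: y z rule: prime_divisors_induct)
  case zero
  then show ?case by simp
next
  case (unit x)
  then have "x = x * 1 \<and> x dvd y \<and> 1 dvd z"
    by (auto intro: unit_imp_dvd)
  then show ?case by blast
next
  case (factor p x)
  from factor have "p \<noteq> 0" "x \<noteq> 0" by auto
  have "p dvd y * z"
    using factor.prems(2) by (rule dvd_mult_left)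
  then consider "p dvd y" | "p dvd z"
    using factor.hyps prime_dvd_mult_iff by blast
  then show ?case
  proof cases
    case 1
    then obtain y' where y': "y = p * y'" ..
    with factor.prems(2) \<open>p \<noteq> 0\<close> have "x dvd y' * z"
      by (simp add: mult.assoc)
    with factor.IH[OF \<open>x \<noteq> 0\<close>] obtain u v where "x = u * v" "u dvd y'" "v dvd z"
      by blast
    then have "p * x = (p * u) * v \<and> p * u dvd y \<and> v dvd z"
      by (simp add: y' mult.assoc)
    then show ?thesis by blast
  next
    case 2
    then obtain z' where z': "z = p * z'" ..
    with factor.prems(2) \<open>p \<noteq> 0\<close> have "x dvd y * z'"
      by (simp add: mult.left_commute)
    with factor.IH[OF \<open>x \<noteq> 0\<close>] obtain u v where "x = u * v" "u dvd y" "v dvd z'"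
      by blast
    then have "p * x = u * (p * v) \<and> u dvd y \<and> p * v dvd z"
      by (simp add: z' mult.left_commute)
    then show ?thesis by blast
  qed
qed

text \<open>
  A singular matrix has rank at most one, so it is a column times a row over the field of
  fractions; primality of \<open>p\<close>, applied to \<open>p dvd q * r\<close>, makes the factors integral.
\<close>

lemma det_zero_column_row:
  fixes p q r s :: "'r::{idom, factorial_semiring}"
  assumes "p * s = q * r"
  obtains g h u v where "p = g * u" "q = g * v" "r = h * u" "s = h * v"
proof (cases "p = 0")
  case False
  from assms have "p dvd q * r" by (metis dvd_triv_left)
  with False obtain g u where gu: "p = g * u" "g dvd q" "u dvd r"
    using dvd_mult_split by blast
  then obtain v h where vh: "q = g * v" "r = h * u"
    by (metis dvdE mult.commute)
  from assms gu vh False have "s = h * v"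
    by (auto simp: mult.assoc mult.left_commute)
  with gu vh show ?thesis by (intro that)
next
  case True
  with assms consider "q = 0" | "r = 0" by auto
  then show ?thesis
  proof cases
    case 1
    with True show ?thesis by (intro that[of 0 r s 1]) auto
  next
    case 2
    with True show ?thesis by (intro that[of q 0 1 s]) auto
  qed
qed

text \<open>
  The idempotent \<open>E = (1 + Z)/2\<close> is the product of the column \<open>(g, h)\<close> and the row \<open>(u, v)\<close>.
  The column spans the image of \<open>E\<close>, where \<open>Z\<close> acts as \<open>1\<close>, and \<open>(-v, u)\<close> spans its kernel,
  where \<open>Z\<close> acts as \<open>-1\<close>; these two eigenvectors are the columns of \<open>P\<close>.
\<close>

lemma involution_conjugate_diagonal:
  fixes a b c :: "'r::{idom, factorial_semiring}"
  assumes two: "(2::'r) dvd 1" and inv: "a\<^sup>2 + b * c = 1"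
  obtains P where "P \<in> GL2" "matrix_inv P ** mat2 a b c (- a) ** P = mat2 1 0 0 (- 1)"
proof -
  \<comment> \<open>\<open>w\<close> is one half.\<close>
  obtain w where w: "2 * w = (1::'r)" using two by (metis dvdE)
  have "(w * (1 + a)) * (w * (1 - a)) = w * w * (1 - a\<^sup>2)"
    by (simp add: algebra_simps power2_eq_square)
  also have "1 - a\<^sup>2 = b * c" using inv by (metis add_diff_cancel_left')
  finally have "(w * (1 + a)) * (w * (1 - a)) = (w * b) * (w * c)"
    by (simp add: algebra_simps)
  then obtain g h u v where E:
    "w * (1 + a) = g * u" "w * b = g * v" "w * c = h * u" "w * (1 - a) = h * v"
    by (rule det_zero_column_row)
  \<comment> \<open>The trace of \<open>E\<close>, which is also the determinant of \<open>P\<close>.\<close>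
  have tr: "g * u + h * v = 1" using w unfolding E[symmetric] by (simp add: algebra_simps)
  have dbl: "2 * (w * x) = x" for x using w by (simp flip: mult.assoc)
  have b: "b = 2 * (g * v)" and c: "c = 2 * (h * u)"
    by (simp_all only: E[symmetric] dbl)
  have "g * u - h * v = 2 * (w * a)" unfolding E[symmetric] by (simp add: algebra_simps)
  then have a: "a = g * u - h * v" by (simp only: dbl)
  define P where "P = mat2 g (- v) h u"
  define Q where "Q = mat2 u v (- h) g"
  have PQ: "P ** Q = mat 1" "Q ** P = mat 1"
    using tr by (simp_all add: P_def Q_def one_eq_mat2 algebra_simps)
  have "P \<in> GL2"
    using tr by (simp add: GL2_def P_def det_mat2 algebra_simps)
  \<comment> \<open>The entries are left as multiples of the trace, since multiplying them out would make
    the identity \<open>tr\<close> unusable for rewriting.\<close>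
  moreover have "mat2 a b c (- a) ** P =
      mat2 (g * (g * u + h * v)) (v * (g * u + h * v)) (h * (g * u + h * v)) (- u * (g * u + h * v))"
    by (simp add: P_def a b c algebra_simps)
  then have "Q ** (mat2 a b c (- a) ** P) = mat2 1 0 0 (- 1)"
    using tr by (simp add: Q_def tr algebra_simps)
  ultimately show ?thesis
    using that matrix_inv_eqI[OF PQ] by (simp add: matrix_mul_assoc)
qed


section \<open>Eigenvalues of inner derivations\<close>

locale domain_algebra = comm_algebra smul
  for smul :: "'f::field \<Rightarrow> 'r::idom \<Rightarrow> 'r" +
  assumes two_neq_zero: "(2::'f) \<noteq> 0"
begin

sublocale M: vector_space "mat_scale smul"
  by (rule vector_space_mat_scale)

text \<open>
  The structure map \<open>F \<rightarrow> R\<close>: it turns scalar multiplication into multiplication in \<open>R\<close>, where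
  ring identities can be used.
\<close>

definition emb :: "'f \<Rightarrow> 'r" where
  "emb k = smul k 1"

lemma smul_eq: "smul k x = emb k * x"
  using scale_mult_left[of k 1 x] by (simp add: emb_def)

lemma emb_simps [simp]:
  "emb 0 = 0" "emb 1 = 1" "emb (k + l) = emb k + emb l" "emb (k * l) = emb k * emb l"
  "emb (- k) = - emb k"
  "emb k = 0 \<longleftrightarrow> k = 0"
  using scale_mult_left[of k "smul l 1" 1] scale_mult_left[of k 1 "smul l 1"]
  by (simp_all add: emb_def scale_left_distrib)

lemma emb_2 [simp]: "emb 2 = 2"
  by (simp only: one_add_one[symmetric] emb_simps)

lemma emb_eq_iff: "emb k = emb l \<longleftrightarrow> k = l"
  using scale_cancel_right[of k 1 l] by (simp add: emb_def)

lemma two_neq_zero_ring: "(2::'r) \<noteq> 0"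
  using emb_simps(6)[of 2] two_neq_zero by simp

lemma two_dvd_one: "(2::'r) dvd 1"
proof
  show "1 = 2 * emb (inverse 2)"
    using two_neq_zero emb_simps(4)[of 2 "inverse 2"] by simp
qed

lemma subspace_sl2: "M.subspace sl2"
  by (rule M.subspaceI) (force simp: sl2_eq zero_eq_mat2 smul_eq)+

lemma bracket_scale_right: "bracket A (mat_scale smul k B) = mat_scale smul k (bracket A B)"
  by (simp add: bracket_def mat_scale_def smul_eq vec_eq_iff matrix_matrix_mult_def
      sum_distrib_left algebra_simps)

lemma bracket_scale_left: "bracket (mat_scale smul k A) B = mat_scale smul k (bracket A B)"
  by (simp add: bracket_def mat_scale_def smul_eq vec_eq_iff matrix_matrix_mult_def
      sum_distrib_left algebra_simps)

lemma subspace_weight_space: "M.subspace (weight_space smul \<aa> \<alpha>)"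
  unfolding weight_space_def
  using M.subspace_0[OF subspace_sl2] M.subspace_add[OF subspace_sl2]
    M.subspace_scale[OF subspace_sl2]
  by (intro M.subspaceI)
    (auto simp: bracket_zero_right bracket_add_right bracket_scale_right M.scale_right_distrib
      mult.commute)

text \<open>
  Applying \<open>(ad Z)\<^sup>3 = 4 d ad Z\<close>, where \<open>d = a\<^sup>2 + b c\<close>, to an eigenvector gives
  \<open>k (k\<^sup>2 - 4 d) = 0\<close> on each of its coordinates, one of which can be cancelled.
\<close>

lemma ad_eigenvalue:
  assumes Y: "(x, y, z) \<noteq> (0, 0, 0)" and k: "k \<noteq> 0"
    and eig: "bracket (mat2 a b c (- a)) (mat2 x y z (- x)) = mat_scale smul k (mat2 x y z (- x))"
  shows "4 * (a\<^sup>2 + b * c) = (emb k)\<^sup>2"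
proof -
  define l where "l = emb k"
  have l: "l \<noteq> 0" using k by (simp add: l_def)
  have e: "b * z - c * y = l * x" "2 * (a * y - b * x) = l * y" "2 * (c * x - a * z) = l * z"
    using eig by (simp_all add: bracket_sl2 smul_eq l_def)
  have "l * (l\<^sup>2 - 4 * (a\<^sup>2 + b * c)) * x = 0" using e by algebra
  moreover have "l * (l\<^sup>2 - 4 * (a\<^sup>2 + b * c)) * y = 0" using e by algebra
  moreover have "l * (l\<^sup>2 - 4 * (a\<^sup>2 + b * c)) * z = 0" using e by algebra
  ultimately show ?thesis using Y l by (auto simp: l_def)
qed

lemma central_sl2_zero:
  fixes Z :: "'r^2^2"
  assumes Z: "Z \<in> sl2" and central: "\<And>X. X \<in> sl2 \<Longrightarrow> bracket Z X = 0"
  shows "Z = 0"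
proof -
  obtain a b c where Z: "Z = mat2 a b c (- a)" using Z by (rule sl2_cases)
  have "bracket Z (mat2 1 0 0 (- 1)) = 0" "bracket Z (mat2 0 1 0 (- 0)) = 0"
    by (rule central, rule mat2_in_sl2)+
  then show ?thesis
    using two_neq_zero_ring unfolding Z bracket_sl2 zero_eq_mat2 by simp
qed

lemma ad_diagonalizable_eigenvector:
  assumes diag: "ad_diagonalizable smul \<aa>" and Z: "Z \<in> \<aa>" "Z \<in> sl2" "Z \<noteq> 0"
  obtains k Y where "k \<noteq> 0" "Y \<in> sl2" "Y \<noteq> 0" "bracket Z Y = mat_scale smul k Y"
proof (rule ccontr)
  assume "\<not> thesis"
  then have none: "k = 0 \<or> Y = 0" if "Y \<in> sl2" "bracket Z Y = mat_scale smul k Y" for k Y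
    using \<open>\<And>Y k. k \<noteq> 0 \<Longrightarrow> Y \<in> sl2 \<Longrightarrow> Y \<noteq> 0 \<Longrightarrow>
      bracket Z Y = mat_scale smul k Y \<Longrightarrow> thesis\<close> that by blast
  have zero: "bracket Z Y = 0" if Y: "Y \<in> weight_space smul \<aa> \<alpha>" for Y \<alpha>
  proof -
    have "bracket Z Y = mat_scale smul (\<alpha> Z) Y" "Y \<in> sl2"
      using Y Z(1) by (auto simp: weight_space_def)
    then show ?thesis using none[of Y "\<alpha> Z"] by (auto simp: bracket_zero_right)
  qed
  have "bracket Z X = 0" if "X \<in> sl2" for X
  proof -
    obtain f where f: "\<forall>i\<in>dual_space smul \<aa>. f i \<in> weight_space smul \<aa> i"
      "\<forall>i. i \<notin> dual_space smul \<aa> \<longrightarrow> f i = 0" "X = (\<Sum>i | f i \<noteq> 0. f i)"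
      using diag \<open>X \<in> sl2\<close> unfolding ad_diagonalizable_def internal_direct_sum_def by metis
    have "bracket Z (f i) = 0" for i
      using f(1,2) zero by (cases "i \<in> dual_space smul \<aa>") (auto simp: bracket_zero_right)
    then show ?thesis by (simp add: f(3) bracket_sum_right)
  qed
  with Z show False using central_sl2_zero by blast
qed

text \<open>
  The scalar \<open>m\<close> is half of a nonzero eigenvalue of \<open>ad Z\<close>, or \<open>0\<close> when \<open>Z = 0\<close>.
\<close>

lemma ad_diagonalizable_square:
  assumes "ad_diagonalizable smul \<aa>" "mat2 a b c (- a) \<in> \<aa>"
  obtains m where "a\<^sup>2 + b * c = (emb m)\<^sup>2" "m = 0 \<longrightarrow> mat2 a b c (- a) = 0"
proof (cases "mat2 a b c (- a) = 0")
  case True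
  then show ?thesis using that[of 0] by (simp add: zero_eq_mat2)
next
  case False
  with assms obtain k Y where Y: "k \<noteq> 0" "Y \<in> sl2" "Y \<noteq> 0"
    "bracket (mat2 a b c (- a)) Y = mat_scale smul k Y"
    by (auto elim: ad_diagonalizable_eigenvector)
  obtain x y z where xyz: "Y = mat2 x y z (- x)" using Y(2) by (rule sl2_cases)
  have k4: "4 * (a\<^sup>2 + b * c) = (emb k)\<^sup>2"
    using Y by (intro ad_eigenvalue[of x y z]) (auto simp: xyz zero_eq_mat2)
  define m where "m = k / 2"
  have km: "k = 2 * m" using two_neq_zero by (simp add: m_def)
  have "2 * 2 * (a\<^sup>2 + b * c) = 2 * 2 * (emb m)\<^sup>2"
    using k4 by (simp add: km power_mult_distrib)
  then have "a\<^sup>2 + b * c = (emb m)\<^sup>2"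
    using two_neq_zero_ring by (metis mult_eq_0_iff mult_cancel_left)
  then show ?thesis using that[of m] Y(1) km by auto
qed

text \<open>
  After rescaling to \<open>Z\<^sup>2 = 1\<close>, let \<open>A\<close> be in the subalgebra.  As \<open>A\<close> commutes with \<open>Z\<close>, the
  product \<open>A Z\<close> is a scalar matrix \<open>t\<close>, so that \<open>A = A Z\<^sup>2 = t Z\<close>.  Then \<open>t\<^sup>2 = A\<^sup>2\<close> is the square of
  an element \<open>k\<close> of \<open>F\<close>, and \<open>t = \<plusminus> k\<close> because \<open>R\<close> is a domain.
\<close>

lemma ad_diagonalizable_span:
  assumes ab: "abelian_subalgebra_sl2 smul \<aa>" and diag: "ad_diagonalizable smul \<aa>"
    and nz: "\<aa> \<noteq> {0}"
  obtains a b c where "a\<^sup>2 + b * c = 1" "\<aa> = M.span {mat2 a b c (- a)}"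
proof -
  have sub: "\<aa> \<subseteq> sl2" "M.subspace \<aa>" "\<And>A B. A \<in> \<aa> \<Longrightarrow> B \<in> \<aa> \<Longrightarrow> bracket A B = 0"
    using ab by (auto simp: abelian_subalgebra_sl2_def lie_subalgebra_sl2_def)
  obtain Z' where Z': "Z' \<in> \<aa>" "Z' \<noteq> 0" using nz M.subspace_0[OF sub(2)] by blast
  obtain a' b' c' where Z'_eq: "Z' = mat2 a' b' c' (- a')" using Z' sub(1) by (blast elim: sl2_cases)
  obtain m where m: "a'\<^sup>2 + b' * c' = (emb m)\<^sup>2" "m \<noteq> 0"
    using ad_diagonalizable_square[OF diag, of a' b' c'] Z' by (auto simp: Z'_eq)
  define n where "n = emb (inverse m)"
  have n: "n * emb m = 1" using m(2) emb_simps(4)[of "inverse m" m] by (simp add: n_def)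
  define a b c where "a = n * a'" and "b = n * b'" and "c = n * c'"
  let ?Z = "mat2 a b c (- a)"
  have Z: "?Z \<in> \<aa>"
    using M.subspace_scale[OF sub(2) Z'(1), of "inverse m"]
    by (simp add: Z'_eq smul_eq a_def b_def c_def n_def)
  have "a\<^sup>2 + b * c = n\<^sup>2 * (a'\<^sup>2 + b' * c')"
    by (simp add: a_def b_def c_def algebra_simps power2_eq_square)
  also have "\<dots> = (n * emb m)\<^sup>2" by (simp add: m(1) power_mult_distrib)
  finally have sq: "a\<^sup>2 + b * c = 1" by (simp add: n)
  have "A \<in> M.span {?Z}" if A: "A \<in> \<aa>" for A
  proof -
    obtain x y z where xyz: "A = mat2 x y z (- x)" using A sub(1) by (blast elim: sl2_cases)
    obtain k where k: "x\<^sup>2 + y * z = (emb k)\<^sup>2"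
      using ad_diagonalizable_square[OF diag] A xyz by metis
    have "bracket ?Z A = 0" using sub(3) Z A .
    then have "b * z - c * y = 0" "2 * (a * y - b * x) = 0" "2 * (c * x - a * z) = 0"
      by (simp_all only: xyz bracket_sl2 zero_eq_mat2 mat2_eq_iff)
    then have comm: "b * z = c * y" "a * y = b * x" "c * x = a * z"
      using two_neq_zero_ring by simp_all
    \<comment> \<open>The first diagonal entry of \<open>Z A\<close>.\<close>
    define t where "t = a * x + b * z"
    have A_eq: "x = t * a" "y = t * b" "z = t * c"
    proof -
      have "t * a = a * (a * x) + a * (b * z)" by (simp add: t_def algebra_simps)
      also have "a * (b * z) = c * (a * y)" by (simp add: comm(1) mult.left_commute)
      also have "a * (a * x) + c * (a * y) = (a\<^sup>2 + b * c) * x"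
        by (simp add: comm(2) algebra_simps power2_eq_square)
      finally show "x = t * a" by (simp add: sq)
      have "t * b = a * (b * x) + b * (b * z)" by (simp add: t_def algebra_simps)
      also have "\<dots> = (a\<^sup>2 + b * c) * y"
        by (simp add: comm(1) comm(2)[symmetric] algebra_simps power2_eq_square)
      finally show "y = t * b" by (simp add: sq)
      have "t * c = a * (c * x) + b * c * z" by (simp add: t_def algebra_simps)
      also have "\<dots> = (a\<^sup>2 + b * c) * z"
        by (simp add: comm(3) algebra_simps power2_eq_square)
      finally show "z = t * c" by (simp add: sq)
    qed
    have "t\<^sup>2 = t\<^sup>2 * (a\<^sup>2 + b * c)" by (simp add: sq)
    also have "\<dots> = x\<^sup>2 + y * z" unfolding A_eq by (simp add: algebra_simps power2_eq_square)
    finally have "t\<^sup>2 = (emb k)\<^sup>2" using k by simp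
    then have "t = emb k \<or> t = emb (- k)" by (simp add: power2_eq_iff)
    then obtain l where "t = emb l" by blast
    then have "A = mat_scale smul l ?Z" by (simp add: xyz A_eq smul_eq)
    then show ?thesis unfolding M.span_singleton by (rule range_eqI)
  qed
  moreover have "M.span {?Z} \<subseteq> \<aa>" using Z sub(2) by (intro M.span_minimal) auto
  ultimately show ?thesis using that[OF sq] by blast
qed


section \<open>The standard diagonal subalgebra\<close>

abbreviation H :: "'r^2^2" where
  "H \<equiv> mat2 1 0 0 (- 1)"

lemma standard_cartan_eq: "standard_cartan smul = range (\<lambda>k. mat_scale smul k H)"
  by (auto simp: standard_cartan_def mat2_def)

lemma H_in_standard_cartan: "H \<in> standard_cartan smul"
  unfolding standard_cartan_eq by (rule range_eqI[of _ _ 1]) (simp add: smul_eq)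

lemma H_neq_zero: "H \<noteq> 0"
  by (simp add: zero_eq_mat2)

lemma bracket_H: "bracket H (mat2 x y z (- x)) = mat2 0 (2 * y) (- 2 * z) 0"
  using bracket_sl2[of 1 0 0 x y z] by simp

lemma abelian_standard_cartan: "abelian_subalgebra_sl2 smul (standard_cartan smul)"
proof -
  have span: "standard_cartan smul = M.span {H}"
    by (simp add: standard_cartan_eq M.span_singleton)
  have H: "H \<in> sl2" by (rule mat2_in_sl2)
  have br: "bracket A B = 0" if "A \<in> standard_cartan smul" "B \<in> standard_cartan smul" for A B
  proof -
    have "bracket H H = 0" by (simp add: bracket_def)
    then show ?thesis
      using that unfolding standard_cartan_eq by (auto simp only: bracket_scale_left bracket_scale_right M.scale_zero_right)
  qed
  have "M.subspace (standard_cartan smul)" unfolding span by (rule M.subspace_span)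
  moreover from this have "0 \<in> standard_cartan smul" by (rule M.subspace_0)
  moreover have "standard_cartan smul \<subseteq> sl2"
    unfolding span using H by (intro M.span_minimal subspace_sl2) auto
  ultimately show ?thesis
    using br by (simp add: abelian_subalgebra_sl2_def lie_subalgebra_sl2_def)
qed

text \<open>
  The functional on \<open>F H\<close> that takes the value \<open>k\<close> at \<open>H\<close>, in the extensional form that
  represents elements of the dual space; these functionals exhaust the dual space.
\<close>

definition weight :: "'f \<Rightarrow> 'r^2^2 \<Rightarrow> 'f" where
  "weight k = restrict (\<lambda>A. k * (THE l. A = mat_scale smul l H)) (standard_cartan smul)"

lemma weight_scale: "weight k (mat_scale smul l H) = k * l"
proof -
  have "(THE l'. mat_scale smul l H = mat_scale smul l' H) = l"
    using H_neq_zero by (intro the_equality) (auto simp only: M.scale_cancel_right)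
  then show ?thesis unfolding weight_def standard_cartan_eq by simp
qed

lemma dual_space_standard_cartan: "dual_space smul (standard_cartan smul) = range weight"
proof (intro equalityI subsetI)
  fix \<alpha> assume \<alpha>: "\<alpha> \<in> dual_space smul (standard_cartan smul)"
  have "\<alpha> = weight (\<alpha> H)"
  proof (rule extensionalityI[of _ "standard_cartan smul"])
    show "\<alpha> \<in> extensional (standard_cartan smul)" using \<alpha> by (simp add: dual_space_def)
    show "weight (\<alpha> H) \<in> extensional (standard_cartan smul)" by (simp add: weight_def)
    fix A assume "A \<in> standard_cartan smul"
    then obtain l where l: "A = mat_scale smul l H" by (auto simp only: standard_cartan_eq)
    have "\<alpha> A = l * \<alpha> H"
      using \<alpha> H_in_standard_cartan unfolding l dual_space_def by blast
    then show "\<alpha> A = weight (\<alpha> H) A" by (simp only: l weight_scale mult.commute)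
  qed
  then show "\<alpha> \<in> range weight" by blast
next
  fix \<alpha> assume "\<alpha> \<in> range weight"
  then obtain k where \<alpha>: "\<alpha> = weight k" by blast
  have "weight k (A + B) = weight k A + weight k B"
    if "A \<in> standard_cartan smul" "B \<in> standard_cartan smul" for A B
    using that unfolding standard_cartan_eq
    by (auto simp only: M.scale_left_distrib[symmetric] weight_scale distrib_left)
  moreover have "weight k (mat_scale smul l A) = l * weight k A"
    if "A \<in> standard_cartan smul" for A l
    using that unfolding standard_cartan_eq
    by (auto simp only: M.scale_scale weight_scale mult.left_commute)
  ultimately show "\<alpha> \<in> dual_space smul (standard_cartan smul)"
    by (simp add: \<alpha> dual_space_def) (simp add: weight_def)
qed

lemma mat2_in_weight_space_iff:
  "mat2 x y z (- x) \<in> weight_space smul (standard_cartan smul) (weight k) \<longleftrightarrow>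
     (k = 0 \<or> x = 0) \<and> (k = 2 \<or> y = 0) \<and> (k = - 2 \<or> z = 0)"
proof -
  let ?Z = "mat2 x y z (- x)"
  have "?Z \<in> weight_space smul (standard_cartan smul) (weight k) \<longleftrightarrow>
      (\<forall>l. mat_scale smul l (bracket H ?Z) = mat_scale smul l (mat_scale smul k ?Z))"
    by (simp only: weight_space_def mem_Collect_eq mat2_in_sl2 standard_cartan_eq ball_simps
        bracket_scale_left weight_scale M.scale_scale mult.commute[of k] simp_thms)
  also have "\<dots> \<longleftrightarrow> bracket H ?Z = mat_scale smul k ?Z"
    by (metis M.scale_one)
  also have "\<dots> \<longleftrightarrow> emb k * x = 0 \<and> emb 2 * y = emb k * y \<and> emb (- 2) * z = emb k * z"
    by (auto simp: bracket_H smul_eq)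
  finally show ?thesis
    by (auto simp only: mult_cancel_right emb_eq_iff mult_eq_0_iff emb_simps(6))
qed

text \<open>
  The functionals with values \<open>0\<close>, \<open>2\<close>, \<open>-2\<close> at \<open>H\<close> have the diagonal, the strictly upper
  and the strictly lower triangular matrices of \<open>sl2\<close> as weight spaces, and all others have
  weight space 0.  So any decomposition is supported on these three functionals, and comparing matrix entries
  determines its components.  The three scalars are distinct since \<open>2 \<noteq> 0\<close>.
\<close>

lemma ad_diagonalizable_standard_cartan: "ad_diagonalizable smul (standard_cartan smul)"
proof -
  let ?W = "weight_space smul (standard_cartan smul)"
  have ne: "(2::'f) \<noteq> - 2" "(2::'f) \<noteq> 0" "- 2 \<noteq> (0::'f)"
  proof -
    show "(2::'f) \<noteq> 0" "- 2 \<noteq> (0::'f)" using two_neq_zero by auto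
    show "(2::'f) \<noteq> - 2"
    proof
      assume "(2::'f) = - 2"
      then have "(2::'f) * 2 = 0" by (simp add: eq_neg_iff_add_eq_0)
      then show False using two_neq_zero mult_eq_0_iff by blast
    qed
  qed
  have weight_inj: "weight k = weight l \<longleftrightarrow> k = l" for k l
    using weight_scale[of _ 1] by (metis mult.right_neutral)
  have decomposition: "\<exists>!f. (\<forall>i\<in>range weight. f i \<in> ?W i) \<and> (\<forall>i. i \<notin> range weight \<longrightarrow> f i = 0) \<and>
      finite {i. f i \<noteq> 0} \<and> v = (\<Sum>i | f i \<noteq> 0. f i)" (is "\<exists>!f. ?P f") if "v \<in> sl2" for v
  proof -
    let ?S = "{weight 0, weight 2, weight (- 2)}"
    obtain x y z where v: "v = mat2 x y z (- x)" using \<open>v \<in> sl2\<close> by (rule sl2_cases)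
    define f where "f = (\<lambda>_. 0)(weight 0 := mat2 x 0 0 (- x), weight 2 := mat2 0 y 0 0,
      weight (- 2) := mat2 0 0 z 0)"
    have f: "f (weight 0) = mat2 x 0 0 (- x)" "f (weight 2) = mat2 0 y 0 0"
      "f (weight (- 2)) = mat2 0 0 z 0"  and f_off: "\<And>i. i \<notin> ?S \<Longrightarrow> f i = 0"
      using ne by (auto simp: f_def weight_inj)
    have sum_S: "(\<Sum>i | h i \<noteq> 0. h i) = h (weight 0) + h (weight 2) + h (weight (- 2))"
      if "\<And>i. i \<notin> ?S \<Longrightarrow> h i = 0" for h :: "('r^2^2 \<Rightarrow> 'f) \<Rightarrow> 'r^2^2"
    proof -
      have "(\<Sum>i | h i \<noteq> 0. h i) = (\<Sum>i\<in>?S. h i)"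
        using that by (intro sum.mono_neutral_left) auto
      also have "\<dots> = h (weight 0) + h (weight 2) + h (weight (- 2))"
        using ne by (simp add: weight_inj add.assoc)
      finally show ?thesis .
    qed
    show ?thesis
    proof (rule ex1I[of _ f])
      have "f (weight k) \<in> ?W (weight k)" for k
      proof (cases "weight k \<in> ?S")
        case True
        then consider "k = 0" | "k = 2" | "k = - 2" by (auto simp: weight_inj)
        then show ?thesis
          using mat2_in_weight_space_iff[of 0 y 0 2] mat2_in_weight_space_iff[of 0 0 z "- 2"]
          by cases (simp_all add: f mat2_in_weight_space_iff)
      next
        case False
        then show ?thesis using f_off M.subspace_0[OF subspace_weight_space] by metis
      qed
      moreover have "finite {i. f i \<noteq> 0}"
        by (rule finite_subset[of _ ?S]) (use f_off in blast, simp)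
      moreover have "v = (\<Sum>i | f i \<noteq> 0. f i)"
        using sum_S[of f] f_off by (simp add: f v)
      ultimately show "?P f" using f_off by blast
    next
      fix h assume h: "?P h"
      have W: "\<exists>x y z. h (weight k) = mat2 x y z (- x) \<and>
          (k = 0 \<or> x = 0) \<and> (k = 2 \<or> y = 0) \<and> (k = - 2 \<or> z = 0)" for k
      proof -
        have k: "h (weight k) \<in> ?W (weight k)" using h by blast
        then have "h (weight k) \<in> sl2" by (simp add: weight_space_def)
        then obtain x y z where "h (weight k) = mat2 x y z (- x)" by (rule sl2_cases)
        with k show ?thesis by (metis mat2_in_weight_space_iff)
      qed
      have h_off: "h i = 0" if "i \<notin> ?S" for i
      proof (cases "i \<in> range weight")
        case True
        then obtain k where "i = weight k" by blast
        with that W[of k] show ?thesis by (auto simp: zero_eq_mat2)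
      qed (use h in blast)
      obtain x' where x': "h (weight 0) = mat2 x' 0 0 (- x')" using W[of 0] ne by auto
      obtain y' where y': "h (weight 2) = mat2 0 y' 0 0" using W[of 2] ne by auto
      obtain z' where z': "h (weight (- 2)) = mat2 0 0 z' 0" using W[of "- 2"] ne by auto
      have "v = h (weight 0) + h (weight 2) + h (weight (- 2))"
        using h sum_S[of h, OF h_off] by simp
      then have "x' = x" "y' = y" "z' = z" by (simp_all add: v x' y' z')
      then show "h = f" using f f_off h_off x' y' z' by (metis ext insertE emptyE)
    qed
  qed
  then show ?thesis
    unfolding ad_diagonalizable_def internal_direct_sum_def dual_space_standard_cartan
    using subspace_sl2 subspace_weight_space by (auto simp: weight_space_def)
qed

lemma MAD_neq_zero:
  assumes "is_MAD smul \<hh>"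
  shows "\<hh> \<noteq> {0}"
proof
  assume "\<hh> = {0}"
  moreover have "0 \<in> standard_cartan smul"
    using abelian_standard_cartan M.subspace_0
    by (auto simp: abelian_subalgebra_sl2_def lie_subalgebra_sl2_def)
  ultimately have "standard_cartan smul = {0}"
    using assms abelian_standard_cartan ad_diagonalizable_standard_cartan
    by (auto simp: is_MAD_def)
  then show False using H_in_standard_cartan H_neq_zero by simp
qed

end


section \<open>Conjugacy of maximal abelian diagonalizable subalgebras\<close>

theorem theorem4:
  fixes smul :: "'f::field \<Rightarrow> 'r::{idom, factorial_semiring} \<Rightarrow> 'r"
    and \<hh>' :: "('r^2^2) set"
  assumes "CHAR('f) \<noteq> 2"
    and "comm_algebra smul"
    and "is_MAD smul \<hh>'"
  shows "vector_space.dim (mat_scale smul) \<hh>' = 1 \<and>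
    (\<exists>P\<in>GL2. (\<lambda>A. matrix_inv P ** A ** P) ` \<hh>' = standard_cartan smul)"
proof -
  have "(2::'f) \<noteq> 0"
  proof
    assume "(2::'f) = 0"
    then have "CHAR('f) dvd 2" using of_nat_eq_0_iff_char_dvd[of 2, where 'a = 'f] by simp
    then have "CHAR('f) = 1 \<or> CHAR('f) = 2"
      using two_is_prime_nat prime_nat_iff by blast
    then show False using assms(1) by simp
  qed
  then interpret domain_algebra smul
    using assms(2) by (simp add: domain_algebra_def domain_algebra_axioms_def)
  obtain a b c where sq: "a\<^sup>2 + b * c = 1" and span: "\<hh>' = M.span {mat2 a b c (- a)}"
    using assms(3) MAD_neq_zero[OF assms(3)] unfolding is_MAD_def by (metis ad_diagonalizable_span)
  let ?Z = "mat2 a b c (- a)"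
  have "?Z \<noteq> 0" using sq by (auto simp: zero_eq_mat2)
  then have "M.dim \<hh>' = 1"
    unfolding span by (subst M.dim_span_eq_card_independent) auto
  moreover obtain P where P: "P \<in> GL2" "matrix_inv P ** ?Z ** P = H"
    using involution_conjugate_diagonal[OF two_dvd_one sq] by metis
  have scale: "B ** mat_scale smul k A ** C = mat_scale smul k (B ** A ** C)"
    for A B C :: "'r^2^2" and k
    by (simp add: mat_scale_def smul_eq vec_eq_iff matrix_matrix_mult_def sum_distrib_left
        sum_distrib_right algebra_simps)
  have "(\<lambda>A. matrix_inv P ** A ** P) ` \<hh>' = standard_cartan smul"
    by (simp only: span M.span_singleton image_image scale P(2) standard_cartan_eq)
  ultimately show ?thesis using P(1) by blast
qed

end
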